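(* Let $0<\alpha\le 1$ and let $F\subset\mathbb{R}$ be an $\alpha$-perfect set with finite integral staircase function $S_F^\alpha$. Let $n\ge1$, let $a_0,a_1,\dots,a_n$ be real constants with $a_0\ne0$, and put $$L[f]=a_0D_F^{n\alpha}f(x)+a_1D_F^{(n-1)\alpha}f(x)+\cdots+a_{n-1}D_F^{\alpha}f(x)+a_nf(x),\qquad Z(r)=a_0r^n+a_1r^{n-1}+\cdots+a_{n-1}r+a_n .$$ Then for every (real or complex) number $r$, $$L[\exp(rS_F^\alpha(x))]=Z(r)\exp(rS_F^\alpha(x)),$$ and consequently, for every $r$ with $Z(r)=0$, the function $f(x)=\exp(rS_F^\alpha(x))$ is a solution of $L[f]=0$.
   Context: Flag function: for a set $F$ and a closed interval $I$, $\rho(F,I)=1$ if $F\cap I\ne\emptyset$ and $0$ otherwise. For $0<\alpha\le1$, $\delta>0$ and $c\le d$, the coarse-grained mass is $$\gamma_\delta^\alpha(F,c,d)=\inf_{|P|\le\delta}\sum_{i=0}^{m-1}\Gamma(\alpha+1)(t_{i+1}-t_i)^\alpha\rho(F,[t_i,t_{i+1}]),$$ the infimum being over subdivisions $P=\{c=t_0<\dots<t_m=d\}$ with $|P|=\max_i(t_{i+1}-t_i)\le\delta$; the mass function is $\gamma^\alpha(F,c,d)=\lim_{\delta\to0}\gamma^\alpha_\delta(F,c,d)$. The integral staircase function is $S_F^\alpha(x)=\gamma^\alpha(F,x_*,x)$ for $x\ge x_*$ and $S_F^\alpha(x)=-\gamma^\alpha(F,x,x_* )$ for $x<x_*$, where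 $x_*$ is a fixed real number. $F$ is $\alpha$-perfect if $F$ is the set of points of change of $S_F^\alpha$ (points having no neighbourhood on which $S_F^\alpha$ is constant) and $F$ is closed with every point a limit point of $F$. The fractal limit $F_{-}\lim_{y\to x}$ is the limit as $y\to x$ through points $y\in F$, $y\neq x$. For a (real- or complex-valued) function $f$ defined on $F$, the $F^\alpha$-derivative at $x\in F$ is $$D_F^\alpha f(x)=F_{-}\lim_{y\to x}\frac{f(y)-f(x)}{S_F^\alpha(y)-S_F^\alpha(x)}$$ if the limit exists. $D_F^{k\alpha}f$ denotes the $k$-fold iterate of $D_F^\alpha$ applied to $f$. All identities and equations are considered at points $x\in F$. *)

theory Defs
  imports "HOL-Analysis.Analysis"
begin

definition flag :: "real set \<Rightarrow> real set \<Rightarrow> real" where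
  "flag F I = (if F \<inter> I \<noteq> {} then 1 else 0)"

(* The subdivision {c = t 0 < ... < t m = d}; for c = d this forces m = 0. *)
definition subdivision :: "real \<Rightarrow> real \<Rightarrow> nat \<Rightarrow> (nat \<Rightarrow> real) \<Rightarrow> bool" where
  "subdivision c d m t \<longleftrightarrow> t 0 = c \<and> t m = d \<and> (\<forall>i<m. t i < t (Suc i))"

(* For \<delta> > 0 and c \<le> d the infimum is over a nonempty set of nonnegative reals,
   so the real-valued Inf is the true infimum. *)
definition coarse_mass :: "real \<Rightarrow> real \<Rightarrow> real set \<Rightarrow> real \<Rightarrow> real \<Rightarrow> real" where
  "coarse_mass \<alpha> \<delta> F c d =
     Inf {(\<Sum>i<m. Gamma (\<alpha> + 1) * (t (Suc i) - t i) powr \<alpha> * flag F {t i..t (Suc i)}) | m t.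
            subdivision c d m t \<and> (\<forall>i<m. t (Suc i) - t i \<le> \<delta>)}"

(* The limit is taken in the extended reals, where it always exists because
   coarse_mass increases as \<delta> decreases; its value may be \<infinity>. *)
definition mass :: "real \<Rightarrow> real set \<Rightarrow> real \<Rightarrow> real \<Rightarrow> ereal" where
  "mass \<alpha> F c d = Lim (at_right 0) (\<lambda>\<delta>. ereal (coarse_mass \<alpha> \<delta> F c d))"

definition staircase_ereal :: "real \<Rightarrow> real set \<Rightarrow> real \<Rightarrow> real \<Rightarrow> ereal" where
  "staircase_ereal \<alpha> F x0 x = (if x \<ge> x0 then mass \<alpha> F x0 x else - mass \<alpha> F x x0)"

definition finite_staircase :: "real \<Rightarrow> real set \<Rightarrow> real \<Rightarrow> bool" where
  "finite_staircase \<alpha> F x0 \<longleftrightarrow> (\<forall>x. \<bar>staircase_ereal \<alpha> F x0 x\<bar> \<noteq> \<infinity>)"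

(* Meaningful only under finite_staircase, since real_of_ereal sends \<infinity> to 0. *)
definition staircase :: "real \<Rightarrow> real set \<Rightarrow> real \<Rightarrow> real \<Rightarrow> real" where
  "staircase \<alpha> F x0 x = real_of_ereal (staircase_ereal \<alpha> F x0 x)"

definition points_of_change :: "(real \<Rightarrow> 'b) \<Rightarrow> real set" where
  "points_of_change g = {x. \<not> (\<exists>U. open U \<and> x \<in> U \<and> g constant_on U)}"

definition alpha_perfect :: "real \<Rightarrow> real set \<Rightarrow> real \<Rightarrow> bool" where
  "alpha_perfect \<alpha> F x0 \<longleftrightarrow>
     F = points_of_change (staircase_ereal \<alpha> F x0) \<and> closed F \<and> (\<forall>x\<in>F. x islimpt F)"

definition F_quotient ::
    "real \<Rightarrow> real set \<Rightarrow> real \<Rightarrow> (real \<Rightarrow> 'a::real_normed_field) \<Rightarrow> real \<Rightarrow> real \<Rightarrow> 'a" where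
  "F_quotient \<alpha> F x0 f x y = (f y - f x) / of_real (staircase \<alpha> F x0 y - staircase \<alpha> F x0 x)"

definition F_differentiable ::
    "real \<Rightarrow> real set \<Rightarrow> real \<Rightarrow> (real \<Rightarrow> 'a::real_normed_field) \<Rightarrow> real \<Rightarrow> bool" where
  "F_differentiable \<alpha> F x0 f x \<longleftrightarrow> (\<exists>D. (F_quotient \<alpha> F x0 f x \<longlongrightarrow> D) (at x within F))"

(* Total operator: an unspecified value wherever F_differentiable fails. At x \<in> F it depends
   only on the values of f on F. *)
definition F_deriv ::
    "real \<Rightarrow> real set \<Rightarrow> real \<Rightarrow> (real \<Rightarrow> 'a::real_normed_field) \<Rightarrow> real \<Rightarrow> 'a" where
  "F_deriv \<alpha> F x0 f x = Lim (at x within F) (F_quotient \<alpha> F x0 f x)"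

definition F_deriv_iter ::
    "real \<Rightarrow> real set \<Rightarrow> real \<Rightarrow> nat \<Rightarrow> (real \<Rightarrow> 'a::real_normed_field) \<Rightarrow> real \<Rightarrow> 'a" where
  "F_deriv_iter \<alpha> F x0 k f = (F_deriv \<alpha> F x0 ^^ k) f"

definition F_times_differentiable ::
    "real \<Rightarrow> real set \<Rightarrow> real \<Rightarrow> nat \<Rightarrow> (real \<Rightarrow> 'a::real_normed_field) \<Rightarrow> bool" where
  "F_times_differentiable \<alpha> F x0 n f \<longleftrightarrow>
     (\<forall>k<n. \<forall>x\<in>F. F_differentiable \<alpha> F x0 (F_deriv_iter \<alpha> F x0 k f) x)"

definition F_diff_op ::
    "real \<Rightarrow> real set \<Rightarrow> real \<Rightarrow> nat \<Rightarrow> (nat \<Rightarrow> real) \<Rightarrow>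
      (real \<Rightarrow> 'a::real_normed_field) \<Rightarrow> real \<Rightarrow> 'a" where
  "F_diff_op \<alpha> F x0 n a f x = (\<Sum>k\<le>n. of_real (a k) * F_deriv_iter \<alpha> F x0 (n - k) f x)"

definition char_fun :: "nat \<Rightarrow> (nat \<Rightarrow> real) \<Rightarrow> 'a::real_normed_field \<Rightarrow> 'a" where
  "char_fun n a r = (\<Sum>k\<le>n. of_real (a k) * r ^ (n - k))"

definition F_solution ::
    "real \<Rightarrow> real set \<Rightarrow> real \<Rightarrow> nat \<Rightarrow> (nat \<Rightarrow> real) \<Rightarrow> (real \<Rightarrow> 'a::real_normed_field) \<Rightarrow> bool" where
  "F_solution \<alpha> F x0 n a f \<longleftrightarrow>
     F_times_differentiable \<alpha> F x0 n f \<and> (\<forall>x\<in>F. F_diff_op \<alpha> F x0 n a f x = 0)"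

definition exp_staircase ::
    "real \<Rightarrow> real set \<Rightarrow> real \<Rightarrow> 'a::{real_normed_field,banach} \<Rightarrow> real \<Rightarrow> 'a" where
  "exp_staircase \<alpha> F x0 r x = exp (r * of_real (staircase \<alpha> F x0 x))"

end

theory Submission
  imports Defs
begin

text \<open>
  Differentiating along \<open>F\<close> against the staircase function \<open>S\<close> is ordinary differentiation in the
  variable \<open>s = S x\<close>, so \<open>exp (r * S x)\<close> has derivative \<open>r * exp (r * S x)\<close> because \<open>exp (r * s)\<close>
  has derivative \<open>r * exp (r * s)\<close>. Iteration multiplies by \<open>r\<close> each time, and a linear combination
  of the iterates produces the characteristic polynomial
  (lemmas \<open>F_deriv_iter_exp_staircase\<close> and \<open>F_diff_op_exp_staircase\<close>).

  The substitution \<open>s = S x\<close> is legitimate provided that \<open>S y\<close> tends to \<open>S x\<close> while differing from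
  it, as \<open>y\<close> tends to \<open>x\<close> within \<open>F\<close> (lemma \<open>filterlim_staircase_at\<close>). Both requirements rest on
  the additivity of the mass (lemma \<open>mass_additive\<close>), which identifies the mass of an interval with
  the increment of \<open>S\<close> over it.

  \<^item> Continuity (lemma \<open>isCont_staircase\<close>): at a fixed scale \<open>\<delta>\<close> the coarse-grained mass of a short
    interval is at most \<open>Gamma (\<alpha> + 1) * h powr \<alpha>\<close> with \<open>h\<close> its length, and by additivity the
    defect between mass and coarse-grained mass on a subinterval is no larger than on the whole
    interval, where it is small once \<open>\<delta>\<close> is small.

  \<^item> Nonzero increments (lemma \<open>eventually_neq_of_points_of_change\<close>): \<open>S\<close> is monotone, so
    \<open>S y = S x\<close> makes it constant between \<open>x\<close> and \<open>y\<close>; no point of \<open>F\<close>, being a point of change,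
    lies strictly between.
\<close>

section \<open>The coarse-grained mass\<close>

definition piece_cost :: "real \<Rightarrow> real set \<Rightarrow> real \<Rightarrow> real \<Rightarrow> real" where
  "piece_cost \<alpha> F u v = Gamma (\<alpha> + 1) * (v - u) powr \<alpha> * flag F {u..v}"

definition subdivision_cost :: "real \<Rightarrow> real set \<Rightarrow> nat \<Rightarrow> (nat \<Rightarrow> real) \<Rightarrow> real" where
  "subdivision_cost \<alpha> F m t = (\<Sum>i<m. piece_cost \<alpha> F (t i) (t (Suc i)))"

definition fine_subdivision ::
    "real \<Rightarrow> real \<Rightarrow> real \<Rightarrow> nat \<Rightarrow> (nat \<Rightarrow> real) \<Rightarrow> bool" where
  "fine_subdivision \<delta> c d m t \<longleftrightarrow> subdivision c d m t \<and> (\<forall>i<m. t (Suc i) - t i \<le> \<delta>)"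

lemma coarse_mass_eq_Inf:
  "coarse_mass \<alpha> \<delta> F c d = Inf {subdivision_cost \<alpha> F m t | m t. fine_subdivision \<delta> c d m t}"
  unfolding coarse_mass_def subdivision_cost_def fine_subdivision_def piece_cost_def ..

lemma piece_cost_nonneg:
  assumes "0 < \<alpha>"
  shows "0 \<le> piece_cost \<alpha> F u v"
  using Gamma_real_pos[of "\<alpha> + 1"] assms by (simp add: piece_cost_def flag_def)

lemma piece_cost_le:
  assumes "0 < \<alpha>" "u \<le> v" "v - u \<le> h"
  shows "piece_cost \<alpha> F u v \<le> Gamma (\<alpha> + 1) * h powr \<alpha>"
proof -
  have "(v - u) powr \<alpha> \<le> h powr \<alpha>"
    using assms by (intro powr_mono2) auto
  then show ?thesis
    using Gamma_real_pos[of "\<alpha> + 1"] assms by (simp add: piece_cost_def flag_def)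
qed

lemma subdivision_cost_nonneg:
  assumes "0 < \<alpha>"
  shows "0 \<le> subdivision_cost \<alpha> F m t"
  unfolding subdivision_cost_def using piece_cost_nonneg[OF assms] by (simp add: sum_nonneg)

lemma fine_subdivision_exists:
  assumes "0 < \<delta>" "c \<le> d"
  shows "\<exists>m t. fine_subdivision \<delta> c d m t"
proof (cases "c = d")
  case True
  then have "fine_subdivision \<delta> c d 0 (\<lambda>_. c)"
    by (simp add: fine_subdivision_def subdivision_def)
  then show ?thesis by blast
next
  case False
  with assms have "c < d" by simp
  obtain m :: nat where m: "(d - c) / \<delta> < real m" using reals_Archimedean2 by blast
  have "0 < (d - c) / \<delta>" using \<open>c < d\<close> assms by simp
  with m have "0 < real m" by linarith
  define t where "t i = c + real i * ((d - c) / real m)" for i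
  have diff: "t (Suc i) - t i = (d - c) / real m" for i
    by (simp add: t_def distrib_right add_divide_distrib diff_divide_distrib)
  have "(d - c) / real m \<le> \<delta>"
    using m \<open>0 < real m\<close> assms by (simp add: field_simps)
  moreover have "0 < (d - c) / real m" using \<open>0 < real m\<close> \<open>c < d\<close> by simp
  ultimately have "t i < t (Suc i)" "t (Suc i) - t i \<le> \<delta>" for i
    using diff[of i] by linarith+
  moreover have "t 0 = c" "t m = d" using \<open>0 < real m\<close> by (auto simp: t_def)
  ultimately have "fine_subdivision \<delta> c d m t"
    by (simp add: fine_subdivision_def subdivision_def)
  then show ?thesis by blast
qed

lemma coarse_mass_le:
  assumes "0 < \<alpha>" "fine_subdivision \<delta> c d m t"
  shows "coarse_mass \<alpha> \<delta> F c d \<le> subdivision_cost \<alpha> F m t"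
  unfolding coarse_mass_eq_Inf
proof (rule cInf_lower)
  show "bdd_below {subdivision_cost \<alpha> F m t |m t. fine_subdivision \<delta> c d m t}"
    using subdivision_cost_nonneg[OF assms(1)] by (intro bdd_belowI[of _ 0]) auto
qed (use assms in blast)

lemma coarse_mass_greatest:
  assumes "0 < \<delta>" "c \<le> d"
    and "\<And>m t. fine_subdivision \<delta> c d m t \<Longrightarrow> z \<le> subdivision_cost \<alpha> F m t"
  shows "z \<le> coarse_mass \<alpha> \<delta> F c d"
  unfolding coarse_mass_eq_Inf
  using fine_subdivision_exists[OF assms(1,2)] assms(3) by (intro cInf_greatest) auto

lemma coarse_mass_nonneg:
  assumes "0 < \<alpha>" "0 < \<delta>" "c \<le> d"
  shows "0 \<le> coarse_mass \<alpha> \<delta> F c d"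
  using assms subdivision_cost_nonneg by (intro coarse_mass_greatest) auto

lemma coarse_mass_antimono:
  assumes "0 < \<alpha>" "0 < \<delta>" "\<delta> \<le> \<epsilon>" "c \<le> d"
  shows "coarse_mass \<alpha> \<epsilon> F c d \<le> coarse_mass \<alpha> \<delta> F c d"
proof (rule coarse_mass_greatest[OF assms(2,4)])
  fix m t assume "fine_subdivision \<delta> c d m t"
  then have "fine_subdivision \<epsilon> c d m t"
    using assms(3) by (fastforce simp: fine_subdivision_def)
  then show "coarse_mass \<alpha> \<epsilon> F c d \<le> subdivision_cost \<alpha> F m t"
    by (rule coarse_mass_le[OF assms(1)])
qed

lemma fine_subdivision_0:
  "fine_subdivision \<delta> c d 0 t \<longleftrightarrow> t 0 = c \<and> c = d"
  by (auto simp: fine_subdivision_def subdivision_def)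

lemma fine_subdivision_Suc:
  "fine_subdivision \<delta> c d (Suc m) t \<longleftrightarrow>
     t 0 = c \<and> c < t 1 \<and> t 1 - c \<le> \<delta> \<and> fine_subdivision \<delta> (t 1) d m (\<lambda>i. t (Suc i))"
  unfolding fine_subdivision_def subdivision_def by (auto simp: All_less_Suc2)

lemma subdivision_cost_Suc:
  "subdivision_cost \<alpha> F (Suc m) t =
     piece_cost \<alpha> F (t 0) (t 1) + subdivision_cost \<alpha> F m (\<lambda>i. t (Suc i))"
  by (simp add: subdivision_cost_def sum.lessThan_Suc_shift del: sum.lessThan_Suc)

lemma fine_subdivision_le:
  "fine_subdivision \<delta> c d m t \<Longrightarrow> c \<le> d"
proof (induction m arbitrary: c t)
  case 0
  then show ?case by (simp add: fine_subdivision_0)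
next
  case (Suc m)
  then have "t 1 \<le> d" "c < t 1" by (auto simp: fine_subdivision_Suc)
  then show ?case by linarith
qed

lemma coarse_mass_refl:
  assumes "0 < \<alpha>" "0 < \<delta>"
  shows "coarse_mass \<alpha> \<delta> F c c = 0"
proof (rule antisym)
  show "coarse_mass \<alpha> \<delta> F c c \<le> 0"
    using coarse_mass_le[OF assms(1), of \<delta> c c 0 "\<lambda>_. c" F]
    by (simp add: fine_subdivision_0 subdivision_cost_def)
qed (use assms coarse_mass_nonneg in auto)

text \<open>Prepending one piece to a subdivision. The comparisons of coarse-grained masses below follow
  from this by induction on the number of pieces, which avoids cutting and pasting index ranges.\<close>

lemma coarse_mass_cons:
  assumes "0 < \<alpha>" "0 < \<delta>" "c < e" "e - c \<le> \<delta>" "e \<le> d"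
  shows "coarse_mass \<alpha> \<delta> F c d \<le> piece_cost \<alpha> F c e + coarse_mass \<alpha> \<delta> F e d"
proof -
  have "coarse_mass \<alpha> \<delta> F c d - piece_cost \<alpha> F c e \<le> coarse_mass \<alpha> \<delta> F e d"
  proof (rule coarse_mass_greatest[OF assms(2,5)])
    fix m t assume t: "fine_subdivision \<delta> e d m t"
    define s where "s i = (case i of 0 \<Rightarrow> c | Suc j \<Rightarrow> t j)" for i
    have "t 0 = e" using t by (auto simp: fine_subdivision_def subdivision_def)
    with t assms have "fine_subdivision \<delta> c d (Suc m) s"
      by (simp add: fine_subdivision_Suc s_def)
    from coarse_mass_le[OF assms(1) this, of F]
    show "coarse_mass \<alpha> \<delta> F c d - piece_cost \<alpha> F c e \<le> subdivision_cost \<alpha> F m t"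
      using \<open>t 0 = e\<close> by (simp add: subdivision_cost_Suc s_def)
  qed
  then show ?thesis by simp
qed

lemma coarse_mass_short_le:
  assumes "0 < \<alpha>" "0 < \<delta>" "c \<le> d" "d - c \<le> \<delta>" "d - c \<le> h"
  shows "coarse_mass \<alpha> \<delta> F c d \<le> Gamma (\<alpha> + 1) * h powr \<alpha>"
proof (cases "c = d")
  case True
  then show ?thesis
    using assms Gamma_real_pos[of "\<alpha> + 1"] by (simp add: coarse_mass_refl)
next
  case False
  then have "coarse_mass \<alpha> \<delta> F c d \<le> piece_cost \<alpha> F c d + coarse_mass \<alpha> \<delta> F d d"
    using assms by (intro coarse_mass_cons) auto
  also have "\<dots> \<le> Gamma (\<alpha> + 1) * h powr \<alpha>"
    using assms piece_cost_le[of \<alpha> c d h F] by (simp add: coarse_mass_refl)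
  finally show ?thesis .
qed

lemma coarse_mass_subadditive:
  assumes "0 < \<alpha>" "0 < \<delta>" "c \<le> e" "e \<le> d"
  shows "coarse_mass \<alpha> \<delta> F c d \<le> coarse_mass \<alpha> \<delta> F c e + coarse_mass \<alpha> \<delta> F e d"
proof -
  have "coarse_mass \<alpha> \<delta> F c d \<le> subdivision_cost \<alpha> F m t + coarse_mass \<alpha> \<delta> F e d"
    if "fine_subdivision \<delta> c e m t" for m t
    using that
  proof (induction m arbitrary: c t)
    case 0
    then show ?case by (simp add: fine_subdivision_0 subdivision_cost_def)
  next
    case (Suc m)
    then have t: "t 0 = c" "c < t 1" "t 1 - c \<le> \<delta>" and
      s: "fine_subdivision \<delta> (t 1) e m (\<lambda>i. t (Suc i))"
      by (auto simp: fine_subdivision_Suc)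
    have "t 1 \<le> d" using fine_subdivision_le[OF s] assms by linarith
    then show ?case
      using coarse_mass_cons[OF assms(1,2) t(2,3), of d F] Suc.IH[OF s] t(1)
      by (simp add: subdivision_cost_Suc)
  qed
  then have "coarse_mass \<alpha> \<delta> F c d - coarse_mass \<alpha> \<delta> F e d \<le> coarse_mass \<alpha> \<delta> F c e"
    by (intro coarse_mass_greatest assms) (simp add: algebra_simps)
  then show ?thesis by simp
qed

text \<open>Inserting the point \<open>y\<close> into a subdivision only alters the piece containing \<open>y\<close>; the two
  halves replacing it have length at most \<open>\<delta>\<close>, and their cost is the error term, which vanishes
  as \<open>\<delta>\<close> tends to 0.\<close>

lemma coarse_mass_superadditive:
  assumes "0 < \<alpha>" "0 < \<delta>" "c \<le> y" "y \<le> d"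
  shows "coarse_mass \<alpha> \<delta> F c y + coarse_mass \<alpha> \<delta> F y d
           \<le> coarse_mass \<alpha> \<delta> F c d + 2 * (Gamma (\<alpha> + 1) * \<delta> powr \<alpha>)"
proof -
  let ?e = "Gamma (\<alpha> + 1) * \<delta> powr \<alpha>"
  have "0 \<le> ?e" using Gamma_real_pos[of "\<alpha> + 1"] assms by simp
  have "coarse_mass \<alpha> \<delta> F c y + coarse_mass \<alpha> \<delta> F y d \<le> subdivision_cost \<alpha> F m t + 2 * ?e"
    if "fine_subdivision \<delta> c d m t" "c \<le> y" for m t
    using that
  proof (induction m arbitrary: c t)
    case 0
    then have "c = d" "y = d" using assms by (auto simp: fine_subdivision_0)
    then show ?case
      using assms \<open>0 \<le> ?e\<close> by (simp add: coarse_mass_refl subdivision_cost_def)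
  next
    case (Suc m)
    then have t: "t 0 = c" "c < t 1" "t 1 - c \<le> \<delta>" and
      s: "fine_subdivision \<delta> (t 1) d m (\<lambda>i. t (Suc i))"
      by (auto simp: fine_subdivision_Suc)
    show ?case
    proof (cases "y < t 1")
      case True
      have "coarse_mass \<alpha> \<delta> F c y \<le> ?e"
        using assms Suc.prems t True by (intro coarse_mass_short_le) auto
      moreover have "coarse_mass \<alpha> \<delta> F y d
          \<le> piece_cost \<alpha> F y (t 1) + coarse_mass \<alpha> \<delta> F (t 1) d"
        using assms Suc.prems t True fine_subdivision_le[OF s] by (intro coarse_mass_cons) auto
      moreover have "piece_cost \<alpha> F y (t 1) \<le> ?e"
        using assms Suc.prems t True by (intro piece_cost_le) auto
      moreover have "coarse_mass \<alpha> \<delta> F (t 1) d \<le> subdivision_cost \<alpha> F m (\<lambda>i. t (Suc i))"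
        using assms s by (intro coarse_mass_le) auto
      moreover have "0 \<le> piece_cost \<alpha> F (t 0) (t 1)"
        by (rule piece_cost_nonneg[OF assms(1)])
      ultimately show ?thesis by (simp add: subdivision_cost_Suc)
    next
      case False
      then have "t 1 \<le> y" by simp
      with coarse_mass_cons[OF assms(1,2) t(2,3) this, of F] Suc.IH[OF s] t(1)
      show ?thesis by (simp add: subdivision_cost_Suc)
    qed
  qed
  then have "coarse_mass \<alpha> \<delta> F c y + coarse_mass \<alpha> \<delta> F y d - 2 * ?e \<le> coarse_mass \<alpha> \<delta> F c d"
    using assms by (intro coarse_mass_greatest) (auto simp: algebra_simps)
  then show ?thesis by simp
qed


section \<open>The mass function\<close>

text \<open>Smaller \<open>\<delta>\<close> admit fewer subdivisions, so the coarse-grained mass increases as \<open>\<delta>\<close> tends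
  to 0 and the limit is a supremum.\<close>

lemma mass_eq_SUP_and_tendsto:
  assumes "0 < \<alpha>" "c \<le> d"
  shows mass_eq_SUP: "mass \<alpha> F c d = (SUP \<delta>\<in>{0<..}. ereal (coarse_mass \<alpha> \<delta> F c d))"
    and coarse_mass_tendsto:
      "((\<lambda>\<delta>. ereal (coarse_mass \<alpha> \<delta> F c d)) \<longlongrightarrow> mass \<alpha> F c d) (at_right 0)"
proof -
  let ?g = "\<lambda>\<delta>. ereal (coarse_mass \<alpha> \<delta> F c d)"
  have lim: "(?g \<longlongrightarrow> (SUP \<delta>\<in>{0<..}. ?g \<delta>)) (at_right 0)"
  proof (rule order_tendstoI)
    fix z assume "z < (SUP \<delta>\<in>{0<..}. ?g \<delta>)"
    then obtain \<epsilon> where "0 < \<epsilon>" "z < ?g \<epsilon>" by (auto simp: less_SUP_iff)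
    have "\<forall>\<^sub>F \<delta> in at_right 0. \<delta> < \<epsilon> \<and> 0 < \<delta>"
      using \<open>0 < \<epsilon>\<close> by (auto simp: eventually_at_right[OF \<open>0 < \<epsilon>\<close>] intro!: exI[of _ \<epsilon>])
    then show "\<forall>\<^sub>F \<delta> in at_right 0. z < ?g \<delta>"
    proof eventually_elim
      case (elim \<delta>)
      then have "?g \<epsilon> \<le> ?g \<delta>" using assms by (simp add: coarse_mass_antimono)
      with \<open>z < ?g \<epsilon>\<close> show ?case by (rule less_le_trans)
    qed
  next
    fix z assume z: "(SUP \<delta>\<in>{0<..}. ?g \<delta>) < z"
    show "\<forall>\<^sub>F \<delta> in at_right 0. ?g \<delta> < z"
      using eventually_at_right_less[of 0]
    proof eventually_elim
      case (elim \<delta>)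
      then have "?g \<delta> \<le> (SUP \<delta>\<in>{0<..}. ?g \<delta>)" by (intro SUP_upper) auto
      then show ?case using z by (rule le_less_trans)
    qed
  qed
  then show eq: "mass \<alpha> F c d = (SUP \<delta>\<in>{0<..}. ?g \<delta>)"
    unfolding mass_def by (intro tendsto_Lim) auto
  show "(?g \<longlongrightarrow> mass \<alpha> F c d) (at_right 0)" using lim by (simp only: eq)
qed

lemma coarse_mass_le_mass:
  assumes "0 < \<alpha>" "0 < \<delta>" "c \<le> d"
  shows "ereal (coarse_mass \<alpha> \<delta> F c d) \<le> mass \<alpha> F c d"
  unfolding mass_eq_SUP[OF assms(1,3)] using assms(2) by (intro SUP_upper) auto

lemma mass_nonneg:
  assumes "0 < \<alpha>" "c \<le> d"
  shows "0 \<le> mass \<alpha> F c d"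
  using coarse_mass_le_mass[OF assms(1) zero_less_one assms(2), of F]
    coarse_mass_nonneg[OF assms(1) zero_less_one assms(2), of F]
  by (meson ereal_less_eq(5) order_trans)

lemma powr_at_right_0_tendsto:
  fixes C \<alpha> :: real
  assumes "0 < \<alpha>"
  shows "((\<lambda>\<delta>. C * \<delta> powr \<alpha>) \<longlongrightarrow> 0) (at_right 0)"
proof -
  have "((\<lambda>\<delta>. \<delta> powr \<alpha>) \<longlongrightarrow> 0) (at_right 0)"
  proof (rule tendsto_zero_powrI)
    show "((\<lambda>\<delta>::real. \<delta>) \<longlongrightarrow> 0) (at_right 0)" by (rule tendsto_ident_at)
    show "\<forall>\<^sub>F x::real in at_right 0. 0 \<le> x"
      using eventually_at_right_less[of "0::real"] by eventually_elim simp
  qed (use assms in auto)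
  from tendsto_mult_left[OF this, of C] show ?thesis by simp
qed

text \<open>Splitting an interval is exact in the limit: at scale \<open>\<delta>\<close> the two sides differ by at most
  a multiple of \<open>\<delta> powr \<alpha>\<close>.\<close>

lemma mass_additive:
  assumes "0 < \<alpha>" "c \<le> e" "e \<le> d"
  shows "mass \<alpha> F c e + mass \<alpha> F e d = mass \<alpha> F c d"
proof -
  let ?M = "\<lambda>c d \<delta>. ereal (coarse_mass \<alpha> \<delta> F c d)"
  let ?e = "\<lambda>\<delta>. 2 * Gamma (\<alpha> + 1) * \<delta> powr \<alpha>"
  have "c \<le> d" using assms by simp
  have sum: "((\<lambda>\<delta>. ?M c e \<delta> + ?M e d \<delta>) \<longlongrightarrow> mass \<alpha> F c e + mass \<alpha> F e d) (at_right 0)"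
    using assms mass_nonneg[of \<alpha> c e F] mass_nonneg[of \<alpha> e d F]
    by (intro tendsto_add_ereal_general coarse_mass_tendsto) auto
  have whole: "(?M c d \<longlongrightarrow> mass \<alpha> F c d) (at_right 0)"
    by (rule coarse_mass_tendsto[OF assms(1) \<open>c \<le> d\<close>])
  have "((\<lambda>\<delta>. ?M c d \<delta> + ereal (?e \<delta>)) \<longlongrightarrow> mass \<alpha> F c d + ereal 0) (at_right 0)"
    using whole powr_at_right_0_tendsto[OF assms(1), of "2 * Gamma (\<alpha> + 1)"]
    by (intro tendsto_add_ereal_general tendsto_ereal) auto
  then have err: "((\<lambda>\<delta>. ?M c d \<delta> + ereal (?e \<delta>)) \<longlongrightarrow> mass \<alpha> F c d) (at_right 0)"
    by (simp flip: zero_ereal_def)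
  show ?thesis
  proof (rule antisym)
    have "\<forall>\<^sub>F \<delta> in at_right 0. ?M c e \<delta> + ?M e d \<delta> \<le> ?M c d \<delta> + ereal (?e \<delta>)"
      using eventually_at_right_less[of 0]
      by eventually_elim (use assms coarse_mass_superadditive in \<open>simp add: mult.assoc\<close>)
    then show "mass \<alpha> F c e + mass \<alpha> F e d \<le> mass \<alpha> F c d"
      by (rule tendsto_le[OF trivial_limit_at_right_real err sum])
  next
    have "\<forall>\<^sub>F \<delta> in at_right 0. ?M c d \<delta> \<le> ?M c e \<delta> + ?M e d \<delta>"
      using eventually_at_right_less[of 0]
      by eventually_elim (use assms coarse_mass_subadditive in simp)
    then show "mass \<alpha> F c d \<le> mass \<alpha> F c e + mass \<alpha> F e d"
      by (rule tendsto_le[OF trivial_limit_at_right_real sum whole])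
  qed
qed

lemma mass_mono:
  assumes "0 < \<alpha>" "c \<le> y" "y \<le> z" "z \<le> d"
  shows "mass \<alpha> F y z \<le> mass \<alpha> F c d"
proof -
  have "mass \<alpha> F y z \<le> mass \<alpha> F c y + mass \<alpha> F y z"
    using assms mass_nonneg[of \<alpha> c y F] by (simp add: ereal_le_add_self2)
  also have "\<dots> = mass \<alpha> F c z" using assms by (simp add: mass_additive)
  also have "\<dots> \<le> mass \<alpha> F c z + mass \<alpha> F z d"
    using assms mass_nonneg[of \<alpha> z d F] by (simp add: ereal_le_add_self)
  also have "\<dots> = mass \<alpha> F c d" using assms by (simp add: mass_additive)
  finally show ?thesis .
qed

text \<open>Fix a scale \<open>\<delta>\<close> at which the coarse-grained mass of the whole interval is within \<open>\<epsilon>\<close> of its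
  supremum. By additivity the mass of a short subinterval then exceeds its coarse-grained mass at
  scale \<open>\<delta>\<close> by at most \<open>\<epsilon>\<close>, and the latter is bounded by the cost of a single piece.\<close>

lemma mass_small_on_short_intervals:
  assumes "0 < \<alpha>" "c \<le> d" "mass \<alpha> F c d \<noteq> \<infinity>" "0 < \<epsilon>"
  obtains \<delta> where "0 < \<delta>"
    and "\<And>y z. c \<le> y \<Longrightarrow> y \<le> z \<Longrightarrow> z \<le> d \<Longrightarrow> z - y < \<delta> \<Longrightarrow> mass \<alpha> F y z < ereal \<epsilon>"
proof -
  obtain M where M: "mass \<alpha> F c d = ereal M"
    using assms mass_nonneg[of \<alpha> c d F] by (cases "mass \<alpha> F c d") auto
  have "ereal (M - \<epsilon> / 2) < mass \<alpha> F c d" using M assms by simp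
  then obtain \<delta>1 where \<delta>1: "0 < \<delta>1" "M - \<epsilon> / 2 < coarse_mass \<alpha> \<delta>1 F c d"
    by (auto simp: mass_eq_SUP[OF assms(1,2)] less_SUP_iff)
  have "\<forall>\<^sub>F h in at_right 0. Gamma (\<alpha> + 1) * h powr \<alpha> < \<epsilon> / 2"
    using powr_at_right_0_tendsto[OF assms(1)] assms(4) by (intro order_tendstoD) auto
  then obtain \<delta>2 where \<delta>2: "0 < \<delta>2" "\<And>h. 0 < h \<Longrightarrow> h < \<delta>2 \<Longrightarrow> Gamma (\<alpha> + 1) * h powr \<alpha> < \<epsilon> / 2"
    by (auto simp: eventually_at_right[OF zero_less_one])
  have "mass \<alpha> F y z < ereal \<epsilon>"
    if yz: "c \<le> y" "y \<le> z" "z \<le> d" "z - y < min \<delta>1 \<delta>2" for y z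
  proof -
    \<comment> \<open>A positive length between \<open>z - y\<close> and the threshold, since \<open>z - y\<close> itself may be 0.\<close>
    define h where "h = (z - y + min \<delta>1 \<delta>2) / 2"
    have h: "0 < h" "h < \<delta>1" "h < \<delta>2" "z - y \<le> h"
      using yz \<delta>1 \<delta>2 by (auto simp: h_def)
    have fin: "mass \<alpha> F u v \<noteq> \<infinity>" "mass \<alpha> F u v \<noteq> -\<infinity>" if "c \<le> u" "u \<le> v" "v \<le> d" for u v
      using mass_mono[OF assms(1) that, of F] M mass_nonneg[OF assms(1) that(2), of F] by auto
    obtain A B C where m: "mass \<alpha> F c y = ereal A" "mass \<alpha> F y z = ereal B" "mass \<alpha> F z d = ereal C"
      using fin[of c y] fin[of y z] fin[of z d] yz
      by (metis ereal_cases order.refl order_trans)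
    have "mass \<alpha> F c y + (mass \<alpha> F y z + mass \<alpha> F z d) = mass \<alpha> F c d"
      using yz assms by (simp add: mass_additive)
    then have tot: "A + (B + C) = M" using m M by simp
    have "coarse_mass \<alpha> \<delta>1 F c d \<le> coarse_mass \<alpha> \<delta>1 F c y + coarse_mass \<alpha> \<delta>1 F y d"
      "coarse_mass \<alpha> \<delta>1 F y d \<le> coarse_mass \<alpha> \<delta>1 F y z + coarse_mass \<alpha> \<delta>1 F z d"
      using yz assms \<delta>1 by (auto intro!: coarse_mass_subadditive)
    moreover have "coarse_mass \<alpha> \<delta>1 F c y \<le> A" "coarse_mass \<alpha> \<delta>1 F z d \<le> C"
      using yz assms \<delta>1 m coarse_mass_le_mass[of \<alpha> \<delta>1 c y F] coarse_mass_le_mass[of \<alpha> \<delta>1 z d F]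
      by auto
    moreover have "coarse_mass \<alpha> \<delta>1 F y z \<le> Gamma (\<alpha> + 1) * h powr \<alpha>"
      using yz h assms \<delta>1 by (intro coarse_mass_short_le) auto
    moreover have "Gamma (\<alpha> + 1) * h powr \<alpha> < \<epsilon> / 2" using \<delta>2 h by auto
    ultimately have "B < \<epsilon>" using tot \<delta>1(2) by linarith
    then show ?thesis using m by simp
  qed
  then show thesis using that[of "min \<delta>1 \<delta>2"] \<delta>1 \<delta>2 by auto
qed


section \<open>The integral staircase function\<close>

lemma staircase_ereal_eq:
  assumes "finite_staircase \<alpha> F x0"
  shows "staircase_ereal \<alpha> F x0 x = ereal (staircase \<alpha> F x0 x)"
  using assms unfolding finite_staircase_def staircase_def by (simp add: ereal_real)

lemma mass_eq_staircase_diff: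
  assumes "0 < \<alpha>" "finite_staircase \<alpha> F x0" "x \<le> y"
  shows "mass \<alpha> F x y = ereal (staircase \<alpha> F x0 y - staircase \<alpha> F x0 x)"
proof -
  let ?S = "staircase \<alpha> F x0"
  have right: "mass \<alpha> F x0 u = ereal (?S u)" if "x0 \<le> u" for u
    using staircase_ereal_eq[OF assms(2), of u] that by (simp add: staircase_ereal_def)
  have left: "mass \<alpha> F u x0 = ereal (- ?S u)" if "u < x0" for u
    using staircase_ereal_eq[OF assms(2), of u] that
    by (simp add: staircase_ereal_def ereal_uminus_eq_reorder)
  consider "x0 \<le> x" | "x < x0" "x0 \<le> y" | "y < x0" by linarith
  then show ?thesis
  proof cases
    case 1
    have "mass \<alpha> F x0 x + mass \<alpha> F x y = mass \<alpha> F x0 y"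
      using 1 assms by (simp add: mass_additive)
    then show ?thesis
      using 1 assms right[of x] right[of y] by (cases "mass \<alpha> F x y") auto
  next
    case 2
    have "mass \<alpha> F x x0 + mass \<alpha> F x0 y = mass \<alpha> F x y"
      using 2 assms by (simp add: mass_additive)
    then show ?thesis using 2 left[of x] right[of y] by auto
  next
    case 3
    have "mass \<alpha> F x y + mass \<alpha> F y x0 = mass \<alpha> F x x0"
      using 3 assms by (simp add: mass_additive)
    then show ?thesis
      using 3 assms left[of x] left[of y] by (cases "mass \<alpha> F x y") auto
  qed
qed

lemma staircase_mono:
  assumes "0 < \<alpha>" "finite_staircase \<alpha> F x0"
  shows "mono (staircase \<alpha> F x0)"
proof (rule monoI)
  fix x y :: real assume "x \<le> y"
  then show "staircase \<alpha> F x0 x \<le> staircase \<alpha> F x0 y"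
    using mass_nonneg[of \<alpha> x y F] mass_eq_staircase_diff[OF assms] assms by auto
qed

lemma isCont_staircase:
  assumes "0 < \<alpha>" "finite_staircase \<alpha> F x0"
  shows "isCont (staircase \<alpha> F x0) x"
  unfolding continuous_at_eps_delta
proof (intro allI impI)
  let ?S = "staircase \<alpha> F x0"
  fix \<epsilon> :: real assume "0 < \<epsilon>"
  have "mass \<alpha> F (x - 1) (x + 1) \<noteq> \<infinity>"
    using mass_eq_staircase_diff[OF assms, of "x - 1" "x + 1"] by simp
  then obtain \<delta> where \<delta>: "0 < \<delta>"
    "\<And>y z. x - 1 \<le> y \<Longrightarrow> y \<le> z \<Longrightarrow> z \<le> x + 1 \<Longrightarrow> z - y < \<delta> \<Longrightarrow> mass \<alpha> F y z < ereal \<epsilon>"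
    using mass_small_on_short_intervals[OF assms(1) _ _ \<open>0 < \<epsilon>\<close>, of "x - 1" "x + 1" F] by auto
  have bound: "\<bar>?S z - ?S y\<bar> < \<epsilon>" if "x - 1 \<le> y" "y \<le> z" "z \<le> x + 1" "z - y < \<delta>" for y z
    using \<delta>(2)[OF that] mass_eq_staircase_diff[OF assms that(2)]
      monoD[OF staircase_mono[OF assms] that(2)] by simp
  have "dist (?S y) (?S x) < \<epsilon>" if "dist y x < min 1 \<delta>" for y
    using that bound[of x y] bound[of y x] by (cases "x \<le> y") (auto simp: dist_real_def)
  then show "\<exists>\<delta>>0. \<forall>y. dist y x < \<delta> \<longrightarrow> dist (?S y) (?S x) < \<epsilon>"
    using \<delta>(1) by (intro exI[of _ "min 1 \<delta>"]) auto
qed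

text \<open>A monotone function taking equal values at \<open>u < v\<close> is constant between them, so no point of
  change lies strictly between.\<close>

lemma no_change_between:
  fixes g :: "real \<Rightarrow> 'b::order"
  assumes "mono g" "u < w" "w < v" "g u = g v"
  shows "w \<notin> points_of_change g"
proof -
  have "g s = g v" if "s \<in> {u<..<v}" for s
  proof (rule antisym)
    show "g s \<le> g v" using that by (auto intro: monoD[OF assms(1)])
    have "g u \<le> g s" using that by (auto intro: monoD[OF assms(1)])
    then show "g v \<le> g s" by (simp add: assms(4))
  qed
  then have "g constant_on {u<..<v}" unfolding constant_on_def by blast
  then show ?thesis
    using assms(2,3) unfolding points_of_change_def
    by (auto intro!: exI[of _ "{u<..<v}"])
qed

text \<open>On either side of \<open>x\<close>, if \<open>g\<close> takes the value \<open>g x\<close> at some other point then the interval up to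
  that point is a gap of the points of change; otherwise any neighbourhood will do.\<close>

lemma eventually_neq_of_points_of_change:
  fixes g :: "real \<Rightarrow> 'b::order"
  assumes "mono g"
  shows "\<forall>\<^sub>F y in at x within points_of_change g. g y \<noteq> g x"
proof -
  let ?F = "points_of_change g"
  have right: "\<exists>b>x. \<forall>y\<in>?F. x < y \<and> y < b \<longrightarrow> g y \<noteq> g x"
  proof (cases "\<exists>b>x. g b = g x")
    case True
    then obtain b where "x < b" "g b = g x" by blast
    then show ?thesis using no_change_between[OF assms, of x _ b] by auto
  next
    case False
    then show ?thesis by (intro exI[of _ "x + 1"]) auto
  qed
  have left: "\<exists>a<x. \<forall>y\<in>?F. a < y \<and> y < x \<longrightarrow> g y \<noteq> g x"
  proof (cases "\<exists>a<x. g a = g x")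
    case True
    then obtain a where "a < x" "g a = g x" by blast
    then show ?thesis using no_change_between[OF assms, of a _ x] by auto
  next
    case False
    then show ?thesis by (intro exI[of _ "x - 1"]) auto
  qed
  obtain a b where "a < x" "x < b"
    and ab: "\<And>y. y \<in> ?F \<Longrightarrow> a < y \<Longrightarrow> y < b \<Longrightarrow> y \<noteq> x \<Longrightarrow> g y \<noteq> g x"
    using left right by (metis linorder_neqE)
  then show ?thesis
    unfolding eventually_at_topological by (intro exI[of _ "{a<..<b}"]) auto
qed

lemma points_of_change_staircase:
  assumes "finite_staircase \<alpha> F x0"
  shows "points_of_change (staircase_ereal \<alpha> F x0) = points_of_change (staircase \<alpha> F x0)"
proof -
  have "staircase_ereal \<alpha> F x0 constant_on U \<longleftrightarrow> staircase \<alpha> F x0 constant_on U" for U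
    unfolding constant_on_def staircase_ereal_eq[OF assms]
    by (metis ereal.inject)
  then show ?thesis by (simp add: points_of_change_def)
qed

text \<open>For \<open>y\<close> in \<open>F\<close> near \<open>x\<close> the increment of the staircase is small and nonzero, which is what
  allows a limit of difference quotients in the staircase variable to be pulled back to \<open>F\<close>.\<close>

lemma filterlim_staircase_at:
  assumes "0 < \<alpha>" "finite_staircase \<alpha> F x0" "alpha_perfect \<alpha> F x0"
  shows "filterlim (staircase \<alpha> F x0) (at (staircase \<alpha> F x0 x)) (at x within F)"
proof (rule filterlim_atI)
  show "(staircase \<alpha> F x0 \<longlongrightarrow> staircase \<alpha> F x0 x) (at x within F)"
    using isCont_staircase[OF assms(1,2), of x] unfolding isCont_def
    by (rule tendsto_within_subset) simp
  have "F = points_of_change (staircase \<alpha> F x0)"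
    using assms(3) points_of_change_staircase[OF assms(2)] by (simp add: alpha_perfect_def)
  then show "\<forall>\<^sub>F y in at x within F. staircase \<alpha> F x0 y \<noteq> staircase \<alpha> F x0 x"
    using eventually_neq_of_points_of_change[OF staircase_mono[OF assms(1,2)], of x] by simp
qed


section \<open>Exponentials of the staircase function\<close>

lemma F_quotient_exp_staircase_tendsto:
  fixes r :: "'a::{real_normed_field,banach}"
  assumes "0 < \<alpha>" "finite_staircase \<alpha> F x0" "alpha_perfect \<alpha> F x0"
  shows "(F_quotient \<alpha> F x0 (exp_staircase \<alpha> F x0 r) x
            \<longlongrightarrow> r * exp_staircase \<alpha> F x0 r x) (at x within F)"
proof -
  let ?S = "staircase \<alpha> F x0"
  have "((\<lambda>z. exp (r * z)) has_field_derivative r * exp (r * of_real (?S x))) (at (of_real (?S x)))"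
    by (auto intro!: derivative_eq_intros)
  then have lim: "((\<lambda>z. (exp (r * z) - exp (r * of_real (?S x))) / (z - of_real (?S x)))
      \<longlongrightarrow> r * exp (r * of_real (?S x))) (at (of_real (?S x)))"
    by (simp add: has_field_derivative_iff)
  have "filterlim (\<lambda>y. of_real (?S y) :: 'a) (at (of_real (?S x))) (at x within F)"
  proof (rule filterlim_atI)
    note S = filterlim_staircase_at[OF assms, of x]
    show "((\<lambda>y. of_real (?S y) :: 'a) \<longlongrightarrow> of_real (?S x)) (at x within F)"
      using S by (intro tendsto_of_real) (simp add: filterlim_at)
    show "\<forall>\<^sub>F y in at x within F. of_real (?S y) \<noteq> (of_real (?S x) :: 'a)"
      using S by (simp add: filterlim_at)
  qed
  from filterlim_compose[OF lim this] show ?thesis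
    by (simp add: F_quotient_def[abs_def] exp_staircase_def)
qed

text \<open>Stated for functions agreeing with a multiple of the exponential on \<open>F\<close> only, because iterated
  \<open>F\<close>-derivatives are determined on \<open>F\<close> alone.\<close>

lemma F_quotient_tendsto_of_eq_on:
  fixes r C :: "'a::{real_normed_field,banach}"
  assumes "0 < \<alpha>" "finite_staircase \<alpha> F x0" "alpha_perfect \<alpha> F x0"
    and "x \<in> F" and g: "\<And>y. y \<in> F \<Longrightarrow> g y = C * exp_staircase \<alpha> F x0 r y"
  shows "(F_quotient \<alpha> F x0 g x \<longlongrightarrow> C * r * exp_staircase \<alpha> F x0 r x) (at x within F)"
proof -
  have "((\<lambda>y. C * F_quotient \<alpha> F x0 (exp_staircase \<alpha> F x0 r) x y)
      \<longlongrightarrow> C * (r * exp_staircase \<alpha> F x0 r x)) (at x within F)"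
    by (intro tendsto_mult_left F_quotient_exp_staircase_tendsto assms)
  moreover have "\<forall>\<^sub>F y in at x within F.
      C * F_quotient \<alpha> F x0 (exp_staircase \<alpha> F x0 r) x y = F_quotient \<alpha> F x0 g x y"
    unfolding eventually_at_filter
    using \<open>x \<in> F\<close> by (simp add: F_quotient_def g algebra_simps)
  ultimately show ?thesis
    by (simp add: tendsto_cong mult.assoc)
qed

lemma F_deriv_iter_exp_staircase:
  fixes r :: "'a::{real_normed_field,banach}"
  assumes "0 < \<alpha>" "finite_staircase \<alpha> F x0" "alpha_perfect \<alpha> F x0" "x \<in> F"
  shows "F_deriv_iter \<alpha> F x0 k (exp_staircase \<alpha> F x0 r) x = r ^ k * exp_staircase \<alpha> F x0 r x"
  using assms(4)
proof (induction k arbitrary: x)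
  case 0
  then show ?case by (simp add: F_deriv_iter_def)
next
  case (Suc k)
  have "F_deriv_iter \<alpha> F x0 (Suc k) (exp_staircase \<alpha> F x0 r) x =
      Lim (at x within F) (F_quotient \<alpha> F x0 (F_deriv_iter \<alpha> F x0 k (exp_staircase \<alpha> F x0 r)) x)"
    by (simp add: F_deriv_iter_def F_deriv_def)
  also have "\<dots> = r ^ k * r * exp_staircase \<alpha> F x0 r x"
  proof (rule tendsto_Lim)
    show "\<not> trivial_limit (at x within F)"
      using assms(3) Suc.prems by (simp add: alpha_perfect_def trivial_limit_within)
  qed (intro F_quotient_tendsto_of_eq_on assms Suc)
  finally show ?case by (simp add: mult.commute)
qed

lemma exp_staircase_F_times_differentiable:
  fixes r :: "'a::{real_normed_field,banach}"
  assumes "0 < \<alpha>" "finite_staircase \<alpha> F x0" "alpha_perfect \<alpha> F x0"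
  shows "F_times_differentiable \<alpha> F x0 n (exp_staircase \<alpha> F x0 r)"
  unfolding F_times_differentiable_def F_differentiable_def
  using F_quotient_tendsto_of_eq_on[OF assms _ F_deriv_iter_exp_staircase[OF assms]] by blast

lemma F_diff_op_exp_staircase:
  fixes r :: "'a::{real_normed_field,banach}"
  assumes "0 < \<alpha>" "finite_staircase \<alpha> F x0" "alpha_perfect \<alpha> F x0" "x \<in> F"
  shows "F_diff_op \<alpha> F x0 n a (exp_staircase \<alpha> F x0 r) x =
           char_fun n a r * exp_staircase \<alpha> F x0 r x"
  by (simp add: F_diff_op_def char_fun_def F_deriv_iter_exp_staircase[OF assms]
      sum_distrib_right mult.assoc)

theorem mainTheorem4:
  fixes \<alpha> x0 :: real and F :: "real set" and n :: nat and a :: "nat \<Rightarrow> real"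
  assumes "0 < \<alpha>" and "\<alpha> \<le> 1"
    and "finite_staircase \<alpha> F x0"
    and "alpha_perfect \<alpha> F x0"
    and "n \<ge> 1"
    and "a 0 \<noteq> 0"
  shows
    "(\<forall>r::real.
       F_times_differentiable \<alpha> F x0 n (exp_staircase \<alpha> F x0 r) \<and>
       (\<forall>x\<in>F. F_diff_op \<alpha> F x0 n a (exp_staircase \<alpha> F x0 r) x =
                char_fun n a r * exp_staircase \<alpha> F x0 r x)) \<and>
     (\<forall>r::complex.
       F_times_differentiable \<alpha> F x0 n (exp_staircase \<alpha> F x0 r) \<and>
       (\<forall>x\<in>F. F_diff_op \<alpha> F x0 n a (exp_staircase \<alpha> F x0 r) x =
                char_fun n a r * exp_staircase \<alpha> F x0 r x)) \<and>
     (\<forall>r::real. char_fun n a r = 0 \<longrightarrow> F_solution \<alpha> F x0 n a (exp_staircase \<alpha> F x0 r)) \<and>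
     (\<forall>r::complex. char_fun n a r = 0 \<longrightarrow> F_solution \<alpha> F x0 n a (exp_staircase \<alpha> F x0 r))"
  by (simp add: F_solution_def exp_staircase_F_times_differentiable[OF assms(1,3,4)]
      F_diff_op_exp_staircase[OF assms(1,3,4)])

end
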